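(* Let $S,T$ be nonempty subsets of $[n-1]$ such that $T_n\langle S;T\rangle$ is a walk-ensured Toeplitz matrix, and let $d=\gcd(S\cup T)$. Then for any positive integer $s^\ast\le n-d$, both $T_n\langle S\cup\{s^\ast\};T\rangle$ and $T_n\langle S;T\cup\{s^\ast\}\rangle$ are walk-ensured Toeplitz matrices.
   Context: Matrices are Boolean ($0,1$ entries with $1+1=1$). For nonempty $S,T\subseteq[n-1]$, $T_n\langle S;T\rangle$ denotes the $n\times n$ $(0,1)$-matrix whose $(i,j)$-entry is $1$ if and only if $j-i\in S$ or $i-j\in T$. Its digraph $D(A)$ has vertex set $[n]$ and an arc $(i,j)$ exactly when the $(i,j)$-entry is $1$. $\gcd(S\cup T)$ is the gcd of all elements of $S\cup T$. Let $s_1=\min S$ and $\gcd(S+T)=\gcd\{s+t: s\in S,t\in T\}$. The matrix $A=T_n\langle S;T\rangle$ is called walk-ensured if there is a positive integer $M$ such that for all vertices $u,v\in[n]$ and every integer $\ell\ge M$ with $v-u\equiv \ell s_1 \pmod{\gcd(S+T)}$, there is a directed walk from $u$ to $v$ of length $\ell$ in $D(A)$. *)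

theory Defs
  imports
    "Jordan_Normal_Form.Matrix"
    "Graph_Theory.Arc_Walk"
    "HOL-Number_Theory.Cong"
begin

(* A Boolean matrix is a bool mat: True is 1, and disjunction is the addition, so 1 + 1 = 1.
   Matrices of the library are indexed from 0; the entry below depends only on the difference
   of the indices, so the shift from [n] = {1..n} does not affect it. *)
definition toeplitz :: "nat \<Rightarrow> nat set \<Rightarrow> nat set \<Rightarrow> bool mat" where
  "toeplitz n S T =
     mat n n (\<lambda>(i, j). int j - int i \<in> int ` S \<or> int i - int j \<in> int ` T)"

(* The vertices are 1, ..., n, so the (i,j)-entry is found at the library index (i-1, j-1). *)
definition digraph_of :: "bool mat \<Rightarrow> (nat, nat \<times> nat) pre_digraph" where
  "digraph_of A =
     \<lparr> verts = {1..dim_row A},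
       arcs = {(i, j). i \<in> {1..dim_row A} \<and> j \<in> {1..dim_row A} \<and> A $$ (i - 1, j - 1)},
       tail = fst,
       head = snd \<rparr>"

(* A walk is a list of arcs, so its length is the length of that list.
   Intended for nonempty S, T \<subseteq> {1..n-1}; these sets are determined by the matrix. *)
definition walk_ensured :: "nat \<Rightarrow> nat set \<Rightarrow> nat set \<Rightarrow> bool" where
  "walk_ensured n S T \<longleftrightarrow>
     (\<exists>M>0. \<forall>u\<in>{1..n}. \<forall>v\<in>{1..n}. \<forall>l\<ge>M.
        [int v - int u = int l * int (Min S)] (mod int (Gcd {s + t | s t. s \<in> S \<and> t \<in> T})) \<longrightarrow>
        (\<exists>p. pre_digraph.awalk (digraph_of (toeplitz n S T)) u p v \<and> length p = l))"

end

theory Submission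
  imports
    Defs
    "Graph_Theory.Digraph_Component"
begin

text \<open>Write \<open>g\<close> for the gcd of \<open>S + T\<close> and \<open>s\<^sub>1\<close> for \<open>Min S\<close>. A new element of \<open>S\<close> or \<open>T\<close> adds arcs of a
  single displacement \<open>c\<close>, and the new modulus divides \<open>v - u - l s\<^sub>1\<close> only if some \<open>k < g\<close> satisfies
  \<open>v - u \<equiv> (l - k) s\<^sub>1 + k c\<close> modulo \<open>g\<close>. So it suffices to use exactly \<open>k\<close> new arcs and to
  connect them by long walks of the old digraph. The tails of the new arcs contain \<open>d\<close> consecutive
  vertices, hence meet every residue class modulo \<open>d = gcd g s\<^sub>1\<close>, and so every vertex has a long
  old walk to one of them.\<close>

text \<open>The Bezout coefficient of \<open>b\<close>, scaled by \<open>x div gcd g b\<close>,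
  solves the congruence; reducing it modulo \<open>g\<close> makes it a natural number below
  \<open>g\<close>.\<close>

lemma ex_multiple_cong:
  fixes g b x :: int
  assumes "g > 0" and "gcd g b dvd x"
  obtains k :: nat where "int k < g" and "g dvd x - int k * b"
proof -
  obtain p q where pq: "p * g + q * b = gcd g b" using bezout_int by blast
  obtain y where y: "x = gcd g b * y" using assms(2) by (elim dvdE)
  define k where "k = nat ((q * y) mod g)"
  have k: "int k = (q * y) mod g" using assms(1) by (simp add: k_def)
  have "x - int k * b = g * (p * y + b * ((q * y) div g))"
    unfolding k minus_mult_div_eq_mod[symmetric] y pq[symmetric] by (simp add: algebra_simps)
  then show ?thesis using that[of k] k assms(1) by simp
qed

text \<open>The combinatorial core, with \<open>W l u v\<close> standing for a walk of length
  \<open>l\<close> and with integer vertices, so that \<open>c\<close> may be negative. Replacing an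
  arc of displacement \<open>b\<close> modulo \<open>g\<close> by one of displacement
  \<open>c\<close> shifts the reachable residue by \<open>c - b\<close>; fewer than \<open>g\<close>
  such shifts cover all multiples of \<open>gcd g (c - b)\<close>.\<close>

lemma ex_walk_mod_gcd:
  fixes W :: "nat \<Rightarrow> int \<Rightarrow> int \<Rightarrow> bool" and V :: "int set" and c b g :: int and M :: nat
  assumes g: "g > 0"
    and old: "\<And>l u v. u \<in> V \<Longrightarrow> v \<in> V \<Longrightarrow> l \<ge> M \<Longrightarrow> g dvd v - u - int l * b \<Longrightarrow> W l u v"
    and new: "\<And>u. u \<in> V \<Longrightarrow> \<exists>a\<in>V. a + c \<in> V \<and> gcd g b dvd a - u \<and> W 1 a (a + c)"
    and append: "\<And>l l' u v w. W l u v \<Longrightarrow> W l' v w \<Longrightarrow> W (l + l') u w"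
    and uv: "u \<in> V" "v \<in> V"
    and l: "l \<ge> nat g * (M + nat g + 1) + M"
    and dvd: "gcd g (c - b) dvd v - u - int l * b"
  shows "W l u v"
proof -
  \<comment> \<open>Here \<open>k\<close> counts the new arcs still to be used. Each has a budget of
    \<open>M + nat g + 1\<close> steps, which pays for the arc and an old walk leading to its tail;
    the last \<open>M\<close> is kept for the final old walk.\<close>
  have walk: "W l u v"
    if "u \<in> V" "v \<in> V" "l \<ge> k * (M + nat g + 1) + M"
      "g dvd v - u - int l * b - int k * (c - b)" for k l u v
    using that
  proof (induction k arbitrary: l u)
    case 0
    then show ?case by (intro old) auto
  next
    case (Suc k)
    obtain a where a: "a \<in> V" "a + c \<in> V" "gcd g b dvd a - u" "W 1 a (a + c)"
      using new Suc.prems(1) by blast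
    \<comment> \<open>Among the \<open>g\<close> consecutive lengths from \<open>M\<close> on, one
      has the residue that an old walk from \<open>u\<close> to \<open>a\<close> requires.\<close>
    have "gcd g b dvd a - u - int M * b" using a(3) by simp
    then obtain j where j: "int j < g" "g dvd a - u - int M * b - int j * b"
      using ex_multiple_cong[OF g] by blast
    define m where "m = M + j"
    have m: "g dvd a - u - int m * b"
      using j(2) by (simp add: m_def algebra_simps)
    have step: "W (m + 1) u (a + c)"
      using append[OF old a(4)] Suc.prems(1) a(1) m by (simp add: m_def)
    have l_ge: "l \<ge> (m + 1) + (k * (M + nat g + 1) + M)"
      using Suc.prems(3) j(1) by (simp add: m_def)
    then have l_eq: "int (l - (m + 1)) = int l - int m - 1" by linarith
    \<comment> \<open>The new arc uses up one summand \<open>c - b\<close>, and the old walk to its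
      tail changes the defect only by a multiple of \<open>g\<close>.\<close>
    have eq: "v - (a + c) - int (l - (m + 1)) * b - int k * (c - b) =
        (v - u - int l * b - int (Suc k) * (c - b)) - (a - u - int m * b)"
      unfolding l_eq by (simp add: algebra_simps)
    have "W (l - (m + 1)) (a + c) v"
    proof (rule Suc.IH)
      show "g dvd v - (a + c) - int (l - (m + 1)) * b - int k * (c - b)"
        unfolding eq using Suc.prems(4) m by (rule dvd_diff)
    qed (use a(2) Suc.prems(2) l_ge in auto)
    from append[OF step this] show ?case using l_ge by simp
  qed
  obtain k where k: "int k < g" "g dvd v - u - int l * b - int k * (c - b)"
    using ex_multiple_cong[OF g dvd] .
  have "k * (M + nat g + 1) \<le> nat g * (M + nat g + 1)"
    by (rule mult_le_mono1) (use k(1) in linarith)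
  then show ?thesis using walk[OF uv _ k(2)] l by linarith
qed

lemma ex_cong_in_interval:
  fixes x lo d :: int
  assumes "d > 0"
  obtains a where "lo \<le> a" "a < lo + d" "d dvd a - x"
proof
  show "lo \<le> lo + (x - lo) mod d" "lo + (x - lo) mod d < lo + d" using assms by simp_all
  have "lo + (x - lo) mod d - x = - d * ((x - lo) div d)"
    unfolding minus_mult_div_eq_mod[symmetric] by simp
  then show "d dvd lo + (x - lo) mod d - x" by simp
qed

definition has_walk :: "nat \<Rightarrow> nat set \<Rightarrow> nat set \<Rightarrow> nat \<Rightarrow> nat \<Rightarrow> nat \<Rightarrow> bool" where
  "has_walk n S T l u v \<longleftrightarrow>
     (\<exists>p. pre_digraph.awalk (digraph_of (toeplitz n S T)) u p v \<and> length p = l)"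

lemma verts_toeplitz [simp]: "verts (digraph_of (toeplitz n S T)) = {1..n}"
  by (simp add: digraph_of_def toeplitz_def)

lemma in_arcs_toeplitz:
  "(i, j) \<in> arcs (digraph_of (toeplitz n S T)) \<longleftrightarrow>
     i \<in> {1..n} \<and> j \<in> {1..n} \<and> (int j - int i \<in> int ` S \<or> int i - int j \<in> int ` T)"
  by (auto simp: digraph_of_def toeplitz_def of_nat_diff)

lemma tail_toeplitz [simp]: "tail (digraph_of (toeplitz n S T)) = fst"
  and head_toeplitz [simp]: "head (digraph_of (toeplitz n S T)) = snd"
  by (simp_all add: digraph_of_def)

lemma wf_digraph_toeplitz: "wf_digraph (digraph_of (toeplitz n S T))"
  by unfold_locales (auto simp: in_arcs_toeplitz)

lemma has_walk_append:
  assumes "has_walk n S T l u v" and "has_walk n S T l' v w"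
  shows "has_walk n S T (l + l') u w"
  using assms wf_digraph.awalk_appendI[OF wf_digraph_toeplitz] length_append
  unfolding has_walk_def by metis

lemma has_walk_arc:
  assumes "(u, v) \<in> arcs (digraph_of (toeplitz n S T))"
  shows "has_walk n S T 1 u v"
  unfolding has_walk_def
  using wf_digraph.arc_implies_awalk[OF wf_digraph_toeplitz assms] by (intro exI[of _ "[(u, v)]"]) simp

lemma has_walk_mono:
  assumes "has_walk n S T l u v" and "S \<subseteq> S'" and "T \<subseteq> T'"
  shows "has_walk n S' T' l u v"
proof -
  have "arcs (digraph_of (toeplitz n S T)) \<subseteq> arcs (digraph_of (toeplitz n S' T'))"
    using assms(2,3) by (intro subrelI) (unfold in_arcs_toeplitz, blast)
  then have "subgraph (digraph_of (toeplitz n S T)) (digraph_of (toeplitz n S' T'))"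
    unfolding subgraph_def compatible_def using wf_digraph_toeplitz by simp
  then show ?thesis
    using assms(1) wf_digraph.subgraph_awalk_imp_awalk[OF wf_digraph_toeplitz]
    unfolding has_walk_def by blast
qed

lemma walk_ensured_iff:
  "walk_ensured n S T \<longleftrightarrow>
     (\<exists>M>0. \<forall>u\<in>{1..n}. \<forall>v\<in>{1..n}. \<forall>l\<ge>M.
        int (Gcd {s + t | s t. s \<in> S \<and> t \<in> T}) dvd int v - int u - int l * int (Min S) \<longrightarrow>
        has_walk n S T l u v)"
  unfolding walk_ensured_def has_walk_def cong_iff_dvd_diff ..

text \<open>Both extensions at once: \<open>c\<close> is the displacement of the new arcs, and
  \<open>lo\<close> starts a window of \<open>d\<close> tails whose heads stay inside
  \<open>{1..n}\<close>. The conditions on \<open>S'\<close> and \<open>T'\<close> say that modulo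
  \<open>gcd g (c - Min S)\<close> every arc, forward or backward, moves by
  \<open>Min S\<close>.\<close>

lemma walk_ensured_extend:
  fixes n lo :: nat and S T S' T' :: "nat set" and c :: int
  defines "d \<equiv> Gcd (S \<union> T)"
    and "g \<equiv> Gcd {s + t | s t. s \<in> S \<and> t \<in> T}"
  assumes ne: "S \<noteq> {}" "T \<noteq> {}" and pos: "S \<subseteq> {1..n - 1}"
    and ensured: "walk_ensured n S T"
    and sub: "S \<subseteq> S'" "T \<subseteq> T'"
    and arc: "\<And>i j. i \<in> {1..n} \<Longrightarrow> j \<in> {1..n} \<Longrightarrow> int j - int i = c \<Longrightarrow>
       (i, j) \<in> arcs (digraph_of (toeplitz n S' T'))"
    and lo: "1 \<le> lo" "lo + d \<le> n + 1" "1 \<le> int lo + c" "int lo + int d + c \<le> int n + 1"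
    and S': "\<And>s. s \<in> S' \<Longrightarrow> gcd (int g) (c - int (Min S)) dvd int s - int (Min S)"
    and T': "\<And>t. t \<in> T' \<Longrightarrow> gcd (int g) (c - int (Min S)) dvd int t + int (Min S)"
    and fin: "finite S'"
  shows "walk_ensured n S' T'"
proof -
  define b where "b = Min S"
  have b: "b \<in> S" unfolding b_def using ne(1) pos by (meson Min_in finite_atLeastAtMost finite_subset)
  have b_pos: "b > 0" using b pos by auto
  obtain t0 where t0: "t0 \<in> T" using ne(2) by blast
  have g_dvd: "int g dvd int s + int t" if "s \<in> S" "t \<in> T" for s t
  proof -
    have "g dvd s + t" unfolding g_def using that by (intro Gcd_dvd) blast
    then show ?thesis by (metis of_nat_add of_nat_dvd_iff)
  qed
  have "g dvd b + t0" using g_dvd[OF b t0] by (metis of_nat_add of_nat_dvd_iff)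
  then have g_pos: "g > 0" using b_pos by (intro Nat.gr0I) auto
  have "d dvd b" unfolding d_def using b by (intro Gcd_dvd) blast
  then have d_pos: "d > 0" using b_pos by (intro Nat.gr0I) auto
  \<comment> \<open>Since \<open>b + t\<close> is a multiple of \<open>g\<close>, the gcd divides
    each \<open>t\<close> in \<open>T\<close>; then \<open>s + t0\<close> gives the same for each
    \<open>s\<close> in \<open>S\<close>.\<close>
  have "gcd g b dvd x" if "x \<in> S \<union> T" for x
  proof -
    let ?h = "gcd (int g) (int b)"
    have h: "?h dvd int s + int t" if "s \<in> S" "t \<in> T" for s t
      using g_dvd[OF that] by (rule dvd_trans[rotated]) simp
    have hT: "?h dvd int t" if "t \<in> T" for t
      using h[OF b that] dvd_add_right_iff[of ?h "int b" "int t"] by simp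
    have "?h dvd int x"
      using that
    proof
      assume "x \<in> S"
      then show ?thesis using h[OF _ t0] hT[OF t0] dvd_add_left_iff by blast
    qed (rule hT)
    then show ?thesis by simp
  qed
  then have "gcd g b dvd d" unfolding d_def by (rule Gcd_greatest)
  then have gcd_dvd: "gcd (int g) (int b) dvd int d" by simp
  obtain M where M: "\<And>u v l. u \<in> {1..n} \<Longrightarrow> v \<in> {1..n} \<Longrightarrow> l \<ge> M \<Longrightarrow>
      int g dvd int v - int u - int l * int b \<Longrightarrow> has_walk n S T l u v"
    using ensured unfolding walk_ensured_iff g_def b_def by blast
  define g' where "g' = Gcd {s + t | s t. s \<in> S' \<and> t \<in> T'}"
  define h where "h = gcd (int g) (c - int b)"
  \<comment> \<open>Modulo \<open>h\<close>, each \<open>s\<close> is \<open>b\<close> and each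
    \<open>t\<close> is \<open>- b\<close>, so all sums vanish. Congruences modulo the new modulus
    \<open>g'\<close> thus hold modulo \<open>h\<close>.\<close>
  have "nat h dvd g'"
    unfolding g'_def
  proof (rule Gcd_greatest)
    fix x assume "x \<in> {s + t | s t. s \<in> S' \<and> t \<in> T'}"
    then obtain s t where st: "s \<in> S'" "t \<in> T'" "x = s + t" by blast
    have "h dvd (int s - int b) + (int t + int b)"
      unfolding h_def b_def by (intro dvd_add S' T' st)
    then have "h dvd int x" by (simp add: st(3))
    then show "nat h dvd x" by (simp add: nat_dvd_iff h_def)
  qed
  then have h_dvd: "h dvd int g'" by (simp add: nat_dvd_iff h_def)
  have "Min S' \<in> S'" using fin b sub(1) by (intro Min_in) auto
  then have h_Min: "h dvd int (Min S') - int b" unfolding h_def b_def by (rule S')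
  show ?thesis
    unfolding walk_ensured_iff g'_def[symmetric]
  proof (intro exI conjI ballI allI impI)
    fix u v l
    assume u: "u \<in> {1..n}" and v: "v \<in> {1..n}" and l: "Suc (g * (M + g + 1) + M) \<le> l"
      and dvd: "int g' dvd int v - int u - int l * int (Min S')"
    \<comment> \<open>A new element may lower the minimum, but \<open>Min S'\<close> and
      \<open>b\<close> agree modulo \<open>h\<close>.\<close>
    have "h dvd (int v - int u - int l * int (Min S')) + int l * (int (Min S') - int b)"
      using dvd_trans[OF h_dvd dvd] h_Min by (intro dvd_add dvd_mult)
    then have h: "h dvd int v - int u - int l * int b" by (simp add: algebra_simps)
    have "has_walk n S' T' l (nat (int u)) (nat (int v))"
    proof (rule ex_walk_mod_gcd[where W = "\<lambda>l u v. has_walk n S' T' l (nat u) (nat v)"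
            and V = "{1..int n}" and g = "int g" and b = "int b" and c = c and M = M])
      fix l x y
      assume xy: "x \<in> {1..int n}" "y \<in> {1..int n}" and "M \<le> l" "int g dvd y - x - int l * int b"
      then have "has_walk n S T l (nat x) (nat y)" by (intro M) auto
      then show "has_walk n S' T' l (nat x) (nat y)" using sub by (rule has_walk_mono)
    next
      fix x
      assume "x \<in> {1..int n}"
      obtain a where a: "int lo \<le> a" "a < int lo + int d" "int d dvd a - x"
        using ex_cong_in_interval[of "int d" "int lo" x] d_pos by auto
      have V: "a \<in> {1..int n}" "a + c \<in> {1..int n}" using a(1,2) lo by auto
      have "has_walk n S' T' 1 (nat a) (nat (a + c))"
        by (rule has_walk_arc[OF arc]) (use V in auto)
      then show "\<exists>a\<in>{1..int n}. a + c \<in> {1..int n} \<and> gcd (int g) (int b) dvd a - x \<and>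
          has_walk n S' T' 1 (nat a) (nat (a + c))"
        using V dvd_trans[OF gcd_dvd a(3)] by blast
    next
      fix l l' x y z
      assume "has_walk n S' T' l (nat x) (nat y)" and "has_walk n S' T' l' (nat y) (nat z)"
      then show "has_walk n S' T' (l + l') (nat x) (nat z)" by (rule has_walk_append)
    qed (use g_pos u v l h in \<open>auto simp: h_def\<close>)
    then show "has_walk n S' T' l u v" by simp
  qed simp
qed

theorem theorem5p4:
  fixes n d s :: nat and S T :: "nat set"
  assumes "S \<noteq> {}" and "S \<subseteq> {1..n - 1}"
    and "T \<noteq> {}" and "T \<subseteq> {1..n - 1}"
    and "walk_ensured n S T"
    and "d = Gcd (S \<union> T)"
    and "s > 0" and "s \<le> n - d"
  shows "walk_ensured n (S \<union> {s}) T \<and> walk_ensured n S (T \<union> {s})"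
proof -
  define g where "g = Gcd {s + t | s t. s \<in> S \<and> t \<in> T}"
  have fin: "finite S" using assms(2) finite_subset by blast
  have b: "Min S \<in> S" using fin assms(1) by simp
  obtain t0 where t0: "t0 \<in> T" using assms(3) by blast
  have g_dvd: "int g dvd int x + int t" if "x \<in> S" "t \<in> T" for x t
  proof -
    have "g dvd x + t" unfolding g_def using that by (intro Gcd_dvd) blast
    then show ?thesis by (metis of_nat_add of_nat_dvd_iff)
  qed
  have S: "gcd (int g) y dvd int x - int (Min S)" if "x \<in> S" for x y
  proof -
    have "int g dvd (int x + int t0) - (int (Min S) + int t0)"
      using that b t0 by (intro dvd_diff g_dvd)
    then show ?thesis by (simp add: gcd_dvdI1)
  qed
  have T: "gcd (int g) y dvd int t + int (Min S)" if "t \<in> T" for t y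
    using g_dvd[OF b that] by (simp add: gcd_dvdI1 add.commute)
  \<comment> \<open>As \<open>s\<close> is positive, the natural subtraction \<open>n - d\<close> is
    not truncated.\<close>
  have d_le: "s + Gcd (S \<union> T) \<le> n" using assms(6-8) by linarith
  have new_S: "gcd (int g) (int s - int (Min S)) dvd int x - int (Min S)" if "x \<in> S \<union> {s}" for x
    using that S by auto
  have "walk_ensured n (S \<union> {s}) T"
  \<comment> \<open>The tails \<open>1, ..., d\<close> have heads \<open>s + 1, ..., s + d\<close>,
    all at most \<open>n\<close>.\<close>
  proof (rule walk_ensured_extend[where S = S and T = T and lo = 1 and c = "int s"])
    show "gcd (int (Gcd {s + t |s t. s \<in> S \<and> t \<in> T})) (int s - int (Min S)) dvd int x - int (Min S)"
      if "x \<in> S \<union> {s}" for x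
      using new_S[OF that] unfolding g_def .
    show "gcd (int (Gcd {s + t |s t. s \<in> S \<and> t \<in> T})) (int s - int (Min S)) dvd int t + int (Min S)"
      if "t \<in> T" for t
      using T[OF that] unfolding g_def .
    show "(i, j) \<in> arcs (digraph_of (toeplitz n (S \<union> {s}) T))"
      if "i \<in> {1..n}" "j \<in> {1..n}" "int j - int i = int s" for i j
      using that by (simp add: in_arcs_toeplitz)
  qed (use assms(1-3,5) d_le fin in auto)
  have new_T: "gcd (int g) (- int s - int (Min S)) dvd int t + int (Min S)" if "t \<in> T \<union> {s}" for t
  proof -
    have "gcd (int g) (- int s - int (Min S)) dvd - (- int s - int (Min S))"
      unfolding dvd_minus_iff by (rule gcd_dvd2)
    then show ?thesis using that T by (auto simp: add.commute)
  qed
  have "walk_ensured n S (T \<union> {s})"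
  \<comment> \<open>The new arcs now go down by \<open>s\<close>, so the window of tails is
    \<open>s + 1, ..., s + d\<close>, with heads \<open>1, ..., d\<close>.\<close>
  proof (rule walk_ensured_extend[where S = S and T = T and lo = "s + 1" and c = "- int s"])
    show "gcd (int (Gcd {s + t |s t. s \<in> S \<and> t \<in> T})) (- int s - int (Min S)) dvd int x - int (Min S)"
      if "x \<in> S" for x
      using S[OF that] unfolding g_def .
    show "gcd (int (Gcd {s + t |s t. s \<in> S \<and> t \<in> T})) (- int s - int (Min S)) dvd int t + int (Min S)"
      if "t \<in> (T \<union> {s})" for t
      using new_T[OF that] unfolding g_def .
    show "(i, j) \<in> arcs (digraph_of (toeplitz n S (T \<union> {s})))"
      if "i \<in> {1..n}" "j \<in> {1..n}" "int j - int i = - int s" for i j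
      using that by (simp add: in_arcs_toeplitz)
  qed (use assms(1-3,5) d_le fin in auto)
  show ?thesis by (intro conjI) fact+
qed

end
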